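(* Let $G=(V,E)$ be a finite strongly connected simple digraph with $|V|=n$ and distance matrix $D$, such that both $DK'=n\mathbf 1$ and $D^TK'=n\mathbf 1$ admit solutions. Suppose that $G$ has out-curvature bounded below by a constant $K>0$, i.e. $\min_v\mu^{\mathrm{out}}(v)\ge K$. Then $$\lambda_1\ \ge\ \frac{\min_{(u,v)\in E}\phi(u)P(u,v)}{2n}\left(\|\mu^{\mathrm{out}}\|_{\ell_1}+\min_v\mu^{\mathrm{out}}(v)\right)\ \ge\ \frac{\min_{(u,v)\in E}\phi(u)P(u,v)}{2n}\,(n+1)K,$$ where $\lambda_1$ is the first nonzero (i.e. second smallest) eigenvalue of the digraph Laplacian $\mathcal L$ of $G$.
   Context: A digraph is simple if it has no multiple arcs and no loops (opposite arcs may both be present); it is strongly connected if every vertex is reachable from every other by a directed path; $d(v,w)$ is the length of a shortest directed path from $v$ to $w$; $D=(d(v,w))_{v,w\in V}$; $\mathbf 1\in\mathbb R^n$ is the all-ones column vector. Steinerberger out-curvature of the digraph: $\mu^{\mathrm{out}}:V\to\mathbb R$ is the solution of $DK'=n\mathbf 1$ if it is unique, and if there are several solutions it is the one achieving $\max_{K'}\min_i K'_i$ over all solutions $K'$. Thus $\sum_{w}d(v,w)\mu^{\mathrm{out}}(w)=n$ for all $v\in V$. Notation: $\|\mu\|_{\ell_1}=\sum_{w\in V}\mu(w)$. Laplacian: let $P\in\mathbb R^{n\times n}$ be the transition matrix $P(u,v)=1/d_u^{\mathrm{out}}$ if $(u,v)\in E$ and $P(u,v)=0$ otherwise, where $d_u^{\mathrm{out}}$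 is the number of arcs leaving $u$. Let $\phi$ be the unique positive left eigenvector (row vector) with $\phi P=\phi$ normalized by $\sum_{v\in V}\phi(v)=1$ (Perron–Frobenius), and let $\Phi$ be the diagonal matrix with $\Phi(v,v)=\phi(v)$. The Laplacian of $G$ is $$\mathcal L=I-\frac{\Phi^{1/2}P\Phi^{-1/2}+\Phi^{-1/2}P^T\Phi^{1/2}}{2},$$ with eigenvalues $0=\lambda_0\le\lambda_1\le\dots\le\lambda_{n-1}$. *)

theory Defs
  imports
    "Graph_Theory.Digraph_Component"
    "Graph_Theory.Shortest_Path"
    "Jordan_Normal_Form.Char_Poly"
begin

text \<open>
  Simple digraphs are the locale \<^locale>\<open>digraph\<close> of the library (finite, no loops, no parallel arcs,
  opposite arcs allowed). Vectors and matrices indexed by the vertices are functions on the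
  vertices; only their values on \<^term>\<open>verts G\<close> matter.
\<close>

text \<open>Shortest-path distance: every arc has weight 1.\<close>

definition graph_dist :: "('a, 'b) pre_digraph \<Rightarrow> 'a \<Rightarrow> 'a \<Rightarrow> real" where
  "graph_dist G v w = real_of_ereal (wf_digraph.\<mu> G (\<lambda>_. 1) v w)"

text \<open>The linear systems $D K = n \mathbf{1}$ and $D^T K = n \mathbf{1}$.\<close>

definition solves_dist :: "('a, 'b) pre_digraph \<Rightarrow> ('a \<Rightarrow> real) \<Rightarrow> bool" where
  "solves_dist G K \<longleftrightarrow>
     (\<forall>v\<in>verts G. (\<Sum>w\<in>verts G. graph_dist G v w * K w) = real (card (verts G)))"

definition solves_dist_transpose :: "('a, 'b) pre_digraph \<Rightarrow> ('a \<Rightarrow> real) \<Rightarrow> bool" where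
  "solves_dist_transpose G K \<longleftrightarrow>
     (\<forall>v\<in>verts G. (\<Sum>w\<in>verts G. graph_dist G w v * K w) = real (card (verts G)))"

text \<open>
  The out-curvature is the solution of $D K = n \mathbf{1}$ if that is unique, and otherwise a
  solution whose smallest entry is maximal. This is a predicate, not a function, because a
  maximiser need not be unique.
\<close>

definition is_out_curvature :: "('a, 'b) pre_digraph \<Rightarrow> ('a \<Rightarrow> real) \<Rightarrow> bool" where
  "is_out_curvature G m \<longleftrightarrow>
     solves_dist G m \<and>
     ((\<forall>K. solves_dist G K \<longrightarrow> (\<forall>v\<in>verts G. K v = m v)) \<or>
      (\<forall>K. solves_dist G K \<longrightarrow> Min (K ` verts G) \<le> Min (m ` verts G)))"

definition transition_prob :: "('a, 'b) pre_digraph \<Rightarrow> 'a \<Rightarrow> 'a \<Rightarrow> real" where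
  "transition_prob G u v = (if u \<rightarrow>\<^bsub>G\<^esub> v then 1 / real (out_degree G u) else 0)"

text \<open>The positive left eigenvector $\phi P = \phi$ with entries summing to 1.\<close>

definition is_perron_vector :: "('a, 'b) pre_digraph \<Rightarrow> ('a \<Rightarrow> real) \<Rightarrow> bool" where
  "is_perron_vector G \<phi> \<longleftrightarrow>
     (\<forall>v\<in>verts G. \<phi> v > 0) \<and>
     (\<forall>v\<in>verts G. (\<Sum>u\<in>verts G. \<phi> u * transition_prob G u v) = \<phi> v) \<and>
     (\<Sum>v\<in>verts G. \<phi> v) = 1"

text \<open>
  Library matrices are indexed by natural numbers, so the Laplacian is taken with respect to an
  enumeration \<^term>\<open>vs\<close> of the vertices; its eigenvalues do not depend on the enumeration.
\<close>

definition transition_matrix :: "('a, 'b) pre_digraph \<Rightarrow> 'a list \<Rightarrow> real mat" where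
  "transition_matrix G vs =
     Matrix.mat (length vs) (length vs) (\<lambda>(i, j). transition_prob G (vs ! i) (vs ! j))"

definition laplacian :: "('a, 'b) pre_digraph \<Rightarrow> ('a \<Rightarrow> real) \<Rightarrow> 'a list \<Rightarrow> real mat" where
  "laplacian G \<phi> vs =
     (let n = length vs;
          P = transition_matrix G vs;
          S = mat_diag n (\<lambda>i. sqrt (\<phi> (vs ! i)));
          R = mat_diag n (\<lambda>i. 1 / sqrt (\<phi> (vs ! i)))
      in 1\<^sub>m n - (1/2) \<cdot>\<^sub>m (S * P * R + R * transpose_mat P * S))"

text \<open>
  The real eigenvalues in increasing order, repeated by algebraic multiplicity. For a symmetric
  matrix of dimension \<open>n\<close>, such as the Laplacian, this list has length \<open>n\<close>.
\<close>

definition sorted_eigenvalues :: "real mat \<Rightarrow> real list" where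
  "sorted_eigenvalues A = sorted_list_of_multiset (proots (char_poly A))"

definition min_arc_flow :: "('a, 'b) pre_digraph \<Rightarrow> ('a \<Rightarrow> real) \<Rightarrow> real" where
  "min_arc_flow G \<phi> = Min ((\<lambda>(u, v). \<phi> u * transition_prob G u v) ` arcs_ends G)"

end

theory Submission
  imports Defs "Jordan_Normal_Form.Schur_Decomposition"
begin

text \<open>
  Write \<open>q u v = \<phi> u * P u v\<close> for the stationary flow, \<open>c\<close> for its minimum over the arcs, and
  \<open>S f\<close> for the sum of \<open>(f u - f v)\<^sup>2\<close> over all arcs. The bound is a Poincare inequality on the digraph
  in which the out-curvature \<open>m\<close> serves as a positive measure against which paths are averaged.

  After the substitution \<open>x u = sqrt (\<phi> u) * f u\<close> the quadratic form of the Laplacian becomes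
  half the sum of \<open>q u v * (f u - f v)\<^sup>2\<close>, because \<open>q\<close> is a circulation: its row sums and its column
  sums are both \<open>\<phi>\<close>. This form is at least \<open>c * S f / 2\<close>, it is nonnegative, and it vanishes for
  constant \<open>f\<close>. The eigenvector for the second eigenvalue can be taken orthogonal to the one that
  comes from \<open>f = 1\<close>, so that \<open>f\<close> has \<open>\<phi>\<close>-mean zero (\<open>second_eigenvector\<close>, \<open>spectral_gap_ge\<close>).

  It remains to bound the \<open>\<phi>\<close>-variance of \<open>f\<close> by \<open>S f\<close>. Cauchy-Schwarz along a shortest path gives
  \<open>(f u - f w)\<^sup>2 \<le> d u w * S f\<close>. Weight this by \<open>\<phi> u * m w\<close> and sum over all pairs. The right-hand side
  becomes \<open>n * S f\<close>, because \<open>m\<close> solves \<open>D m = n 1\<close> and \<open>\<phi>\<close> has total mass 1. On the left the mixed term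
  vanishes as \<open>f\<close> has \<open>\<phi>\<close>-mean zero; what is left is the total of \<open>m\<close> times the sum of
  \<open>\<phi> u * (f u)\<^sup>2\<close>, plus the sum of \<open>m w * (f w)\<^sup>2\<close>. As \<open>\<phi> \<le> 1\<close>, the latter is at least \<open>min m\<close> times the
  sum of \<open>\<phi> u * (f u)\<^sup>2\<close>, and this is where the summand \<open>min m\<close> of the bound comes from
  (\<open>poincare_inequality\<close>).
\<close>

section \<open>The second eigenvalue of a positive semidefinite matrix\<close>

lemma symmetric_adjoint:
  fixes A :: "'a :: comm_semiring_0 mat"
  assumes A: "A \<in> carrier_mat n n" "transpose_mat A = A"
    and x: "x \<in> carrier_vec n" and y: "y \<in> carrier_vec n"
  shows "(A *\<^sub>v x) \<bullet> y = x \<bullet> (A *\<^sub>v y)"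
  using transpose_vec_mult_scalar[OF A(1) y x] A(2) by simp

text \<open>
  If \<open>A v = a v\<close> then \<open>A\<close> maps the conjugate of \<open>v\<close> to \<open>cnj a\<close> times itself, so moving \<open>A\<close> across the
  Hermitian product of \<open>v\<close> with itself turns \<open>a\<close> into \<open>cnj a\<close>.
\<close>

lemma real_symmetric_complex_eigenvalue_real:
  fixes A :: "real mat"
  assumes A: "A \<in> carrier_mat n n" "transpose_mat A = A"
    and a: "eigenvalue (map_mat complex_of_real A) a"
  shows "a \<in> \<real>"
proof -
  let ?C = "map_mat complex_of_real A"
  have C: "?C \<in> carrier_mat n n" "transpose_mat ?C = ?C"
    using A by (auto simp: map_mat_transpose)
  obtain v where v: "v \<in> carrier_vec n" "v \<noteq> 0\<^sub>v n" "?C *\<^sub>v v = a \<cdot>\<^sub>v v"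
    using a C unfolding eigenvalue_def eigenvector_def by auto
  have cv: "conjugate v \<in> carrier_vec n" using v by simp
  have "?C *\<^sub>v conjugate v = conjugate (?C *\<^sub>v v)"
    using A v(1) by (intro eq_vecI) (auto simp: scalar_prod_def)
  also have "\<dots> = cnj a \<cdot>\<^sub>v conjugate v" unfolding v(3) by (intro eq_vecI) auto
  finally have conj: "?C *\<^sub>v conjugate v = cnj a \<cdot>\<^sub>v conjugate v" .
  have "a * (v \<bullet>c v) = (?C *\<^sub>v v) \<bullet>c v" using v cv by simp
  also have "\<dots> = v \<bullet> (?C *\<^sub>v conjugate v)" by (rule symmetric_adjoint[OF C v(1) cv])
  also have "\<dots> = cnj a * (v \<bullet>c v)" using v cv by (simp add: conj)
  finally have "a = cnj a" using v by simp
  then show ?thesis by (simp add: Reals_cnj_iff)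
qed

lemma symmetric_char_poly_splits:
  fixes A :: "real mat"
  assumes A: "A \<in> carrier_mat n n" "transpose_mat A = A"
  shows "\<exists>es. char_poly A = (\<Prod>e\<leftarrow>es. [:- e, 1:]) \<and> length es = n"
proof -
  interpret h: map_poly_inj_idom_hom complex_of_real ..
  let ?C = "map_mat complex_of_real A"
  have C: "?C \<in> carrier_mat n n" using A by auto
  obtain as where as: "char_poly ?C = (\<Prod>a\<leftarrow>as. [:- a, 1:])" "length as = n"
    using char_poly_factorized[OF C] by blast
  have "a \<in> \<real>" if "a \<in> set as" for a
  proof (rule real_symmetric_complex_eigenvalue_real[OF A])
    show "eigenvalue ?C a"
      unfolding eigenvalue_root_char_poly[OF C] as
      using that by (auto simp: poly_prod_list prod_list_zero_iff)
  qed
  then have "map complex_of_real (map Re as) = as"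
    by (auto simp: o_def intro!: map_idI elim!: Reals_cases)
  then have "map_poly complex_of_real (char_poly A)
      = (\<Prod>a\<leftarrow>map complex_of_real (map Re as). [:- a, 1:])"
    using as(1) of_real_hom.char_poly_hom[OF A(1), where 'a=complex] by simp
  also have "\<dots> = map_poly complex_of_real (\<Prod>e\<leftarrow>map Re as. [:- e, 1:])"
    unfolding h.hom_prod_list by (simp add: o_def)
  finally have "char_poly A = (\<Prod>e\<leftarrow>map Re as. [:- e, 1:])"
    by (simp only: h.eq_iff)
  then show ?thesis using as(2) by (intro exI[of _ "map Re as"]) auto
qed

lemma sorted_eigenvalues_symmetric:
  fixes A :: "real mat"
  assumes A: "A \<in> carrier_mat n n" "transpose_mat A = A"
  shows "char_poly A = (\<Prod>e\<leftarrow>sorted_eigenvalues A. [:- e, 1:])"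
    and "length (sorted_eigenvalues A) = n"
    and "e \<in> set (sorted_eigenvalues A) \<Longrightarrow> eigenvalue A e"
proof -
  obtain es where es: "char_poly A = (\<Prod>e\<leftarrow>es. [:- e, 1:])" "length es = n"
    using symmetric_char_poly_splits[OF A] by blast
  have "proots (\<Prod>e\<leftarrow>es. [:- e, 1:]) = mset es" for es :: "real list"
  proof (induct es)
    case (Cons e es)
    have "(\<Prod>e\<leftarrow>es. [:- e, 1:]) \<noteq> 0" by (auto simp: prod_list_zero_iff)
    then have "proots ([:- e, 1:] * (\<Prod>e\<leftarrow>es. [:- e, 1:]))
        = proots [:- e, 1:] + proots (\<Prod>e\<leftarrow>es. [:- e, 1:])"
      by (intro proots_mult) auto
    then show ?case using Cons by simp
  qed simp
  then have m: "mset (sorted_eigenvalues A) = mset es"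
    unfolding sorted_eigenvalues_def es(1) by simp
  show len: "length (sorted_eigenvalues A) = n"
    using es(2) mset_eq_length[OF m] by simp
  have "prod_mset (image_mset (\<lambda>e. [:- e, 1:]) (mset (sorted_eigenvalues A)))
      = prod_mset (image_mset (\<lambda>e. [:- e, 1:]) (mset es))" by (simp only: m)
  then show cp: "char_poly A = (\<Prod>e\<leftarrow>sorted_eigenvalues A. [:- e, 1:])"
    unfolding es(1) by (simp flip: mset_map add: prod_mset_prod_list)
  show "eigenvalue A e" if "e \<in> set (sorted_eigenvalues A)"
    unfolding eigenvalue_root_char_poly[OF A(1)] cp
    using that by (auto simp: poly_prod_list prod_list_zero_iff)
qed

text \<open>
  A double root of the characteristic polynomial yields only a generalised eigenspace of dimension
  two, which symmetry makes an honest one. In a Schur basis whose first two diagonal entries are 0,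
  the first basis vector \<open>y\<close> lies in the kernel and the second, \<open>z\<close>, is mapped to a multiple of \<open>y\<close>.
  Hence \<open>A (A z) = 0\<close>, so \<open>A z\<close> is orthogonal to itself and \<open>z\<close> is in the kernel too. A
  two-dimensional kernel contains a nonzero vector orthogonal to the given \<open>s\<close>.
\<close>

lemma double_zero_root_kernel:
  fixes A :: "real mat"
  assumes A: "A \<in> carrier_mat n n" "transpose_mat A = A"
    and s: "s \<in> carrier_vec n"
    and cp: "char_poly A = (\<Prod>e\<leftarrow>0 # 0 # es. [:- e, 1:])"
  shows "\<exists>x\<in>carrier_vec n. x \<noteq> 0\<^sub>v n \<and> x \<bullet> s = 0 \<and> A *\<^sub>v x = 0\<^sub>v n"
proof -
  obtain B P Q where "schur_decomposition A (0 # 0 # es) = (B, P, Q)"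
    by (cases "schur_decomposition A (0 # 0 # es)")
  from schur_decomposition[OF A(1) cp this]
  have sim: "similar_mat_wit A B P Q" and ut: "upper_triangular B"
    and diag: "diag_mat B = 0 # 0 # es" by auto
  note w = similar_mat_witD2[OF A(1) sim]
  have n: "n = length (0 # 0 # es)"
    using w(5) by (simp add: diag[symmetric] diag_mat_def)
  then have n1: "0 < n" "1 < n" by auto
  have "B $$ (0,0) = diag_mat B ! 0" "B $$ (1,1) = diag_mat B ! 1"
    unfolding diag_mat_def using w(5) n1 by simp_all
  then have d: "B $$ (0,0) = 0" "B $$ (1,1) = 0" by (simp_all add: diag)
  define y where "y = col P 0"
  define z where "z = col P 1"
  have yz: "y \<in> carrier_vec n" "z \<in> carrier_vec n"
    unfolding y_def z_def using w(6) by auto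
  have "A * P = P * B * (Q * P)"
    unfolding w(3) by (rule assoc_mult_mat) (use w in auto)
  then have AP: "A * P = P * B" unfolding w(2) using w by auto
  have AB: "A *\<^sub>v col P j = P *\<^sub>v col B j" if "j < n" for j
    using arg_cong[OF AP, of "\<lambda>M. col M j"] w(4-6) that col_mult2 by metis
  have "col B 0 = 0\<^sub>v n"
  proof (rule eq_vecI)
    fix i assume "i < dim_vec (0\<^sub>v n :: real vec)"
    then have i: "i < n" by simp
    have "B $$ (i,0) = 0" using d(1) ut w(5) i by (cases "i = 0") auto
    then show "col B 0 $ i = 0\<^sub>v n $ i" using w(5) i n1 by simp
  qed (use w(5) in auto)
  then have Ay: "A *\<^sub>v y = 0\<^sub>v n"
    unfolding y_def using AB[OF n1(1)] w(6) by auto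
  have "col B 1 = B $$ (0,1) \<cdot>\<^sub>v unit_vec n 0"
  proof (rule eq_vecI)
    fix i assume "i < dim_vec (B $$ (0,1) \<cdot>\<^sub>v unit_vec n 0 :: real vec)"
    then have i: "i < n" by simp
    consider "i = 0" | "i = 1" | "i > 1" by linarith
    then show "col B 1 $ i = (B $$ (0,1) \<cdot>\<^sub>v unit_vec n 0) $ i"
    proof cases
      case 3
      then have "B $$ (i,1) = 0" using ut w(5) i by auto
      then show ?thesis using 3 i w(5) n1 by simp
    qed (use d w(5) n1 i in auto)
  qed (use w(5) in auto)
  moreover have "P *\<^sub>v unit_vec n 0 = col P 0"
    using w(6) n1 by (intro eq_vecI) auto
  ultimately have Az: "A *\<^sub>v z = B $$ (0,1) \<cdot>\<^sub>v y"
    unfolding y_def z_def using AB[OF n1(2)] w(6) n1 by (simp add: mult_mat_vec)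
  have Az_c: "A *\<^sub>v z \<in> carrier_vec n" using A(1) yz(2) by (rule mult_mat_vec_carrier)
  have "A *\<^sub>v (A *\<^sub>v z) = 0\<^sub>v n"
    unfolding Az using A yz Ay by (auto simp add: mult_mat_vec)
  then have "(A *\<^sub>v z) \<bullet> (A *\<^sub>v z) = 0"
    using symmetric_adjoint[OF A yz(2) Az_c] yz by simp
  then have Az0: "A *\<^sub>v z = 0\<^sub>v n"
    using conjugate_square_eq_0_vec[OF Az_c] by simp
  \<comment> \<open>The combination of \<open>y\<close> and \<open>z\<close> orthogonal to \<open>s\<close>; if \<open>y\<close> already is, its coefficients
    \<open>z \<bullet> s\<close> and \<open>- (y \<bullet> s)\<close> might both vanish, and \<open>y\<close> itself is used.\<close>
  define a b where "a = (if y \<bullet> s = 0 then 1 else z \<bullet> s)"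
    and "b = (if y \<bullet> s = 0 then 0 else - (y \<bullet> s))"
  let ?x = "a \<cdot>\<^sub>v y + b \<cdot>\<^sub>v z"
  have "?x \<bullet> s = a * (y \<bullet> s) + b * (z \<bullet> s)"
    using yz s by (subst add_scalar_prod_distrib) auto
  also have "\<dots> = 0" unfolding a_def b_def by auto
  finally have "?x \<bullet> s = 0" .
  moreover have "A *\<^sub>v ?x = 0\<^sub>v n"
    using A yz Ay Az0 by (auto simp add: mult_add_distrib_mat_vec mult_mat_vec)
  moreover have "?x \<noteq> 0\<^sub>v n"
  proof
    assume x0: "?x = 0\<^sub>v n"
    have "Q *\<^sub>v y = col (Q * P) 0" "Q *\<^sub>v z = col (Q * P) 1"
      unfolding y_def z_def using w n1 by (metis col_mult2)+
    then have Qyz: "Q *\<^sub>v y = unit_vec n 0" "Q *\<^sub>v z = unit_vec n 1"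
      unfolding w(2) using n1 by auto
    have "Q *\<^sub>v ?x = a \<cdot>\<^sub>v unit_vec n 0 + b \<cdot>\<^sub>v unit_vec n 1"
      using w(7) yz Qyz by (simp add: mult_add_distrib_mat_vec mult_mat_vec)
    moreover have "Q *\<^sub>v 0\<^sub>v n = 0\<^sub>v n" using w(7) by (intro eq_vecI) auto
    ultimately have "a \<cdot>\<^sub>v unit_vec n 0 + b \<cdot>\<^sub>v unit_vec n 1 = 0\<^sub>v n"
      using x0 by simp
    then have "(a \<cdot>\<^sub>v unit_vec n 0 + b \<cdot>\<^sub>v unit_vec n 1) $ 0 = (0::real)"
      "(a \<cdot>\<^sub>v unit_vec n 0 + b \<cdot>\<^sub>v unit_vec n 1) $ 1 = (0::real)" using n1 by simp_all
    then have "a = 0" "b = 0" using n1 by simp_all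
    then show False unfolding a_def b_def by (auto split: if_splits)
  qed
  ultimately show ?thesis using yz by (intro bexI[of _ ?x]) auto
qed

text \<open>
  If the second eigenvalue is not 0, its eigenvectors are orthogonal to the kernel vector \<open>s\<close>. If it is
  0, then so is the first, as no eigenvalue is negative; thus 0 is a double root of the
  characteristic polynomial.
\<close>

lemma second_eigenvector:
  fixes A :: "real mat"
  assumes A: "A \<in> carrier_mat n n" "transpose_mat A = A" and n: "2 \<le> n"
    and psd: "\<And>x. x \<in> carrier_vec n \<Longrightarrow> 0 \<le> x \<bullet> (A *\<^sub>v x)"
    and s: "s \<in> carrier_vec n" and As: "A *\<^sub>v s = 0\<^sub>v n"
    and l: "l = sorted_eigenvalues A ! 1"
  shows "\<exists>x\<in>carrier_vec n. x \<noteq> 0\<^sub>v n \<and> x \<bullet> s = 0 \<and> A *\<^sub>v x = l \<cdot>\<^sub>v x"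
proof -
  let ?es = "sorted_eigenvalues A"
  note es = sorted_eigenvalues_symmetric[OF A]
  obtain e r where r: "?es = e # l # r"
    using es(2) n l by (cases ?es; cases "tl ?es") auto
  have "sorted ?es" unfolding sorted_eigenvalues_def by simp
  then have el: "e \<le> l" unfolding r by simp
  have ev: "\<exists>x\<in>carrier_vec n. x \<noteq> 0\<^sub>v n \<and> A *\<^sub>v x = k \<cdot>\<^sub>v x" if "k \<in> set ?es" for k
    using es(3)[OF that] A unfolding eigenvalue_def eigenvector_def by auto
  obtain x where x: "x \<in> carrier_vec n" "x \<noteq> 0\<^sub>v n" "A *\<^sub>v x = e \<cdot>\<^sub>v x"
    using ev[of e] r by auto
  have "x \<bullet> x > 0"
    using conjugate_square_greater_0_vec[OF x(1)] x(2) by simp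
  moreover have "0 \<le> e * (x \<bullet> x)" using psd[OF x(1)] x by simp
  ultimately have e0: "0 \<le> e" by (simp add: zero_le_mult_iff)
  show ?thesis
  proof (cases "l = 0")
    case True
    then have "char_poly A = (\<Prod>e\<leftarrow>0 # 0 # r. [:- e, 1:])"
      using es(1) e0 el r by simp
    from double_zero_root_kernel[OF A s this] obtain x where
      x: "x \<in> carrier_vec n" "x \<noteq> 0\<^sub>v n" "x \<bullet> s = 0" "A *\<^sub>v x = 0\<^sub>v n" by blast
    then have "A *\<^sub>v x = l \<cdot>\<^sub>v x" using True by auto
    then show ?thesis using x by blast
  next
    case False
    obtain x where x: "x \<in> carrier_vec n" "x \<noteq> 0\<^sub>v n" "A *\<^sub>v x = l \<cdot>\<^sub>v x"
      using ev[of l] r by auto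
    have "l * (x \<bullet> s) = (A *\<^sub>v x) \<bullet> s" using x s by simp
    also have "\<dots> = 0" using symmetric_adjoint[OF A x(1) s] As x by simp
    finally show ?thesis using x False by auto
  qed
qed

section \<open>A Poincare inequality from the distance equation\<close>

lemma sum_list_squared_le:
  fixes g :: "'a \<Rightarrow> real"
  assumes "distinct xs"
  shows "(\<Sum>x\<leftarrow>xs. g x)\<^sup>2 \<le> real (length xs) * (\<Sum>x\<in>set xs. (g x)\<^sup>2)"
proof (cases "xs = []")
  case False
  define k T where "k = real (length xs)" and "T = (\<Sum>x\<in>set xs. g x)"
  have k: "k > 0" "real (card (set xs)) = k"
    using False assms by (simp_all add: k_def distinct_card)
  \<comment> \<open>Cauchy-Schwarz against the constant 1 is the nonnegativity of the variance of \<open>g\<close>.\<close>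
  have "0 \<le> (\<Sum>x\<in>set xs. (k * g x - T)\<^sup>2)" by (rule sum_nonneg) simp
  also have "\<dots> = k\<^sup>2 * (\<Sum>x\<in>set xs. (g x)\<^sup>2) - 2 * k * T * T + k * T\<^sup>2"
    by (simp add: power2_diff sum.distrib sum_subtractf k(2) power_mult_distrib
        T_def sum_distrib_left mult_ac)
  also have "\<dots> = k * (k * (\<Sum>x\<in>set xs. (g x)\<^sup>2) - T\<^sup>2)"
    by (simp add: algebra_simps power2_eq_square)
  finally have "T\<^sup>2 \<le> k * (\<Sum>x\<in>set xs. (g x)\<^sup>2)"
    using k(1) by (simp add: zero_le_mult_iff)
  then show ?thesis
    using assms by (simp add: k_def T_def sum_list_distinct_conv_sum_set)
qed simp

lemma (in wf_digraph) awalk_telescope: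
  fixes f :: "'a \<Rightarrow> real"
  assumes "awalk u p v"
  shows "(\<Sum>e\<leftarrow>p. f (tail G e) - f (head G e)) = f u - f v"
  using assms by (induct p arbitrary: u) (auto simp: awalk_Cons_iff awalk_Nil_iff)

definition arc_energy :: "('a, 'b) pre_digraph \<Rightarrow> ('a \<Rightarrow> real) \<Rightarrow> real" where
  "arc_energy G f = (\<Sum>e\<in>arcs G. (f (tail G e) - f (head G e))\<^sup>2)"

lemma (in fin_digraph) exists_shortest_path:
  assumes "u \<rightarrow>\<^sup>* v"
  shows "\<exists>p. apath u p v \<and> graph_dist G u v = real (length p)"
proof -
  obtain p where p: "apath u p v" "\<mu> (\<lambda>_. 1) u v = awalk_cost (\<lambda>_. 1) p"
    using min_cost_awalk[OF assms, of "\<lambda>_. 1"] by auto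
  have "awalk_cost (\<lambda>_. 1) p = real (length p)"
    by (induct p) auto
  then show ?thesis using p by (auto simp: graph_dist_def)
qed

lemma (in fin_digraph) graph_dist_self:
  assumes "v \<in> verts G"
  shows "graph_dist G v v = 0"
proof -
  obtain p where p: "apath v p v" "graph_dist G v v = real (length p)"
    using exists_shortest_path[of v v] assms by auto
  then have "p = []" using apath_nonempty_ends by blast
  then show ?thesis using p by simp
qed

text \<open>
  On a single vertex the distance matrix is 0, so the system reads \<open>0 = 1\<close>. Two vertices are what
  makes the second eigenvalue exist and every out-degree positive.
\<close>

lemma (in fin_digraph) solves_dist_card_ge_2:
  assumes "solves_dist G m" "verts G \<noteq> {}"
  shows "2 \<le> card (verts G)"
proof (rule ccontr)
  assume "\<not> 2 \<le> card (verts G)"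
  moreover have "card (verts G) \<noteq> 0" using assms(2) by simp
  ultimately have "card (verts G) = 1" by linarith
  then obtain v where "verts G = {v}" by (rule card_1_singletonE)
  then show False using assms(1) graph_dist_self[of v] by (simp add: solves_dist_def)
qed

text \<open>
  The increments of \<open>f\<close> along a shortest path add up to \<open>f u - f v\<close>. Such a path repeats no arc, so the
  sum of their squares is part of the arc energy.
\<close>

lemma (in fin_digraph) squared_difference_le_dist_energy:
  assumes "u \<rightarrow>\<^sup>* v"
  shows "(f u - f v)\<^sup>2 \<le> graph_dist G u v * arc_energy G f"
proof -
  obtain p where p: "apath u p v" and len: "graph_dist G u v = real (length p)"
    using exists_shortest_path[OF assms] by blast
  have walk: "awalk u p v" and dist: "distinct p"
    using p by (auto simp: apath_def dest: distinct_verts_imp_distinct)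
  have "(f u - f v)\<^sup>2 = (\<Sum>e\<leftarrow>p. f (tail G e) - f (head G e))\<^sup>2"
    using awalk_telescope[OF walk] by simp
  also have "\<dots> \<le> real (length p) * (\<Sum>e\<in>set p. (f (tail G e) - f (head G e))\<^sup>2)"
    by (rule sum_list_squared_le[OF dist])
  also have "\<dots> \<le> real (length p) * arc_energy G f"
    unfolding arc_energy_def using walk
    by (intro mult_left_mono sum_mono2) (auto simp: awalk_def)
  finally show ?thesis by (simp add: len)
qed

text \<open>
  Both sides bound the sum of \<open>p u * m w * (f u - f w)\<^sup>2\<close> over all pairs: from below by expanding
  the square, from above by the path estimate and the distance equation.
\<close>

lemma (in fin_digraph) poincare_inequality:
  assumes sc: "strongly_connected G"
    and m: "solves_dist G m" "\<And>v. v \<in> verts G \<Longrightarrow> k \<le> m v" "0 \<le> k"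
    and p: "\<And>v. v \<in> verts G \<Longrightarrow> 0 \<le> p v" "(\<Sum>v\<in>verts G. p v) = 1"
    and f: "(\<Sum>v\<in>verts G. p v * f v) = 0"
  shows "((\<Sum>w\<in>verts G. m w) + k) * (\<Sum>v\<in>verts G. p v * (f v)\<^sup>2)
    \<le> real (card (verts G)) * arc_energy G f"
proof -
  let ?V = "verts G"
  have p1: "p v \<le> 1" if "v \<in> ?V" for v
    using member_le_sum[of v ?V p] that p by auto
  have "k * (\<Sum>v\<in>?V. p v * (f v)\<^sup>2) = (\<Sum>v\<in>?V. k * (p v * (f v)\<^sup>2))"
    by (rule sum_distrib_left)
  also have "\<dots> \<le> (\<Sum>w\<in>?V. m w * (f w)\<^sup>2)"
  proof (rule sum_mono)
    fix v assume v: "v \<in> ?V"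
    have "k * p v \<le> m v * 1" using m(2)[OF v] m(3) p1[OF v] p(1)[OF v] by (intro mult_mono) auto
    then show "k * (p v * (f v)\<^sup>2) \<le> m v * (f v)\<^sup>2"
      by (simp add: mult_right_mono flip: mult.assoc)
  qed
  finally have "((\<Sum>w\<in>?V. m w) + k) * (\<Sum>v\<in>?V. p v * (f v)\<^sup>2)
      \<le> (\<Sum>w\<in>?V. m w) * (\<Sum>v\<in>?V. p v * (f v)\<^sup>2) + (\<Sum>w\<in>?V. m w * (f w)\<^sup>2)"
    by (simp add: distrib_right)
  \<comment> \<open>The mixed term vanishes and the total mass of \<open>p\<close> is 1; they are inserted to complete the square.\<close>
  also have "\<dots> = (\<Sum>w\<in>?V. m w) * (\<Sum>v\<in>?V. p v * (f v)\<^sup>2)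
      - 2 * (\<Sum>v\<in>?V. p v * f v) * (\<Sum>w\<in>?V. m w * f w)
      + (\<Sum>v\<in>?V. p v) * (\<Sum>w\<in>?V. m w * (f w)\<^sup>2)"
    using f p by simp
  also have "\<dots> = (\<Sum>u\<in>?V. p u * (\<Sum>w\<in>?V. m w * (f u - f w)\<^sup>2))"
  proof -
    have "p u * (\<Sum>w\<in>?V. m w * (f u - f w)\<^sup>2)
        = p u * (f u)\<^sup>2 * (\<Sum>w\<in>?V. m w) - 2 * (p u * f u) * (\<Sum>w\<in>?V. m w * f w)
          + p u * (\<Sum>w\<in>?V. m w * (f w)\<^sup>2)" for u
      unfolding sum_distrib_left sum.distrib[symmetric] sum_subtractf[symmetric]
      by (intro sum.cong refl) (simp add: power2_eq_square algebra_simps)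
    then show ?thesis
      by (simp only: sum.distrib sum_subtractf sum_distrib_right[symmetric]
          sum_distrib_left[symmetric]) (simp add: mult_ac)
  qed
  also have "\<dots> \<le> (\<Sum>u\<in>?V. p u * (\<Sum>w\<in>?V. m w * (graph_dist G u w * arc_energy G f)))"
  proof (intro sum_mono mult_left_mono)
    fix u w assume uw: "u \<in> ?V" "w \<in> ?V"
    show "(f u - f w)\<^sup>2 \<le> graph_dist G u w * arc_energy G f"
      using sc uw by (intro squared_difference_le_dist_energy) auto
    show "0 \<le> m w" using m(2)[OF uw(2)] m(3) by simp
  qed (use p in auto)
  also have "\<dots> = (\<Sum>u\<in>?V. p u * ((\<Sum>w\<in>?V. graph_dist G u w * m w) * arc_energy G f))"
    by (simp add: sum_distrib_left sum_distrib_right mult_ac)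
  also have "\<dots> = (\<Sum>u\<in>?V. p u * (real (card ?V) * arc_energy G f))"
    using m(1) by (intro sum.cong) (auto simp: solves_dist_def)
  also have "\<dots> = real (card ?V) * arc_energy G f"
    using p(2) by (simp flip: sum_distrib_right)
  finally show ?thesis .
qed

lemma (in digraph) arc_energy_le_weighted:
  fixes q :: "'a \<Rightarrow> 'a \<Rightarrow> real"
  assumes "\<And>u v. (u, v) \<in> arcs_ends G \<Longrightarrow> c \<le> q u v" and "\<And>u v. u \<in> verts G \<Longrightarrow> 0 \<le> q u v"
  shows "c * arc_energy G f \<le> (\<Sum>u\<in>verts G. \<Sum>v\<in>verts G. q u v * (f u - f v)\<^sup>2)"
proof -
  have "arc_energy G f = (\<Sum>(u, v)\<in>arcs_ends G. (f u - f v)\<^sup>2)"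
    unfolding arc_energy_def arcs_ends_def
    by (subst sum.reindex[OF inj_on_arc_to_ends]) (simp add: arc_to_ends_def)
  then have "c * arc_energy G f = (\<Sum>(u, v)\<in>arcs_ends G. c * (f u - f v)\<^sup>2)"
    by (simp add: sum_distrib_left case_prod_unfold)
  also have "\<dots> \<le> (\<Sum>(u, v)\<in>arcs_ends G. q u v * (f u - f v)\<^sup>2)"
    using assms(1) by (intro sum_mono) (auto intro: mult_right_mono)
  also have "\<dots> \<le> (\<Sum>(u, v)\<in>verts G \<times> verts G. q u v * (f u - f v)\<^sup>2)"
    using assms(2) by (intro sum_mono2) (auto dest: adj_in_verts)
  finally show ?thesis by (simp add: sum.cartesian_product)
qed

text \<open>
  Expanding the square on the right, row sums give the terms with \<open>(f u)\<^sup>2\<close> and column sums those with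
  \<open>(f v)\<^sup>2\<close>; both totals are the sum of \<open>p u * (f u)\<^sup>2\<close>. The directed flow enters the mixed terms only
  through its symmetric part, which is why the symmetrised form on the left has the same value.
\<close>

lemma circulation_energy:
  fixes q :: "'a \<Rightarrow> 'a \<Rightarrow> real"
  assumes row: "\<And>u. u \<in> V \<Longrightarrow> (\<Sum>v\<in>V. q u v) = p u"
    and col: "\<And>v. v \<in> V \<Longrightarrow> (\<Sum>u\<in>V. q u v) = p v"
  shows "(\<Sum>u\<in>V. f u * (p u * f u - (\<Sum>v\<in>V. (q u v + q v u) * f v) / 2))
    = (\<Sum>u\<in>V. \<Sum>v\<in>V. q u v * (f u - f v)\<^sup>2) / 2"
proof -
  let ?X = "\<Sum>u\<in>V. \<Sum>v\<in>V. q u v * f u * f v"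
  let ?Y = "\<Sum>u\<in>V. p u * (f u)\<^sup>2"
  have 1: "(\<Sum>u\<in>V. \<Sum>v\<in>V. q u v * (f u)\<^sup>2) = ?Y"
    using row by (simp flip: sum_distrib_right)
  have 2: "(\<Sum>u\<in>V. \<Sum>v\<in>V. q u v * (f v)\<^sup>2) = ?Y"
    using col by (subst sum.swap) (simp flip: sum_distrib_right)
  have 3: "(\<Sum>u\<in>V. \<Sum>v\<in>V. q v u * f u * f v) = ?X"
    by (subst sum.swap) (simp add: mult_ac)
  have "(\<Sum>u\<in>V. \<Sum>v\<in>V. q u v * (f u - f v)\<^sup>2)
      = (\<Sum>u\<in>V. \<Sum>v\<in>V. q u v * (f u)\<^sup>2) + (\<Sum>u\<in>V. \<Sum>v\<in>V. q u v * (f v)\<^sup>2) - 2 * ?X"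
    unfolding sum_distrib_left sum.distrib[symmetric] sum_subtractf[symmetric]
    by (intro sum.cong refl) (simp add: power2_eq_square algebra_simps)
  also have "\<dots> = 2 * (?Y - ?X)" using 1 2 by simp
  finally have e: "(\<Sum>u\<in>V. \<Sum>v\<in>V. q u v * (f u - f v)\<^sup>2) / 2 = ?Y - ?X" by simp
  have "(\<Sum>u\<in>V. f u * (p u * f u - (\<Sum>v\<in>V. (q u v + q v u) * f v) / 2))
      = ?Y - (?X + (\<Sum>u\<in>V. \<Sum>v\<in>V. q v u * f u * f v)) / 2"
    unfolding sum.distrib[symmetric] sum_subtractf[symmetric] sum_divide_distrib
    by (intro sum.cong refl)
       (simp add: power2_eq_square algebra_simps sum_distrib_left sum_divide_distrib
        add_divide_distrib sum.distrib)
  then show ?thesis using e 3 by simp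
qed

lemma (in digraph) out_degree_eq_card_successors:
  "out_degree G u = card {v \<in> verts G. u \<rightarrow> v}"
proof -
  have "inj_on (head G) (out_arcs G u)"
    by (rule inj_onI) (auto intro!: no_multi_arcs simp: arc_to_ends_def)
  moreover have "head G ` out_arcs G u = {v \<in> verts G. u \<rightarrow> v}"
    by (auto simp: arcs_ends_conv)
  ultimately show ?thesis
    unfolding out_degree_def by (metis card_image)
qed

text \<open>
  Strong connectivity with a second vertex provides an outgoing arc; without one the row would be 0.
\<close>

lemma (in digraph) transition_prob_sum:
  assumes "strongly_connected G" "2 \<le> card (verts G)" and u: "u \<in> verts G"
  shows "(\<Sum>v\<in>verts G. transition_prob G u v) = 1"
proof -
  have "\<exists>v\<in>verts G. v \<noteq> u"
    using assms(2) card_mono[of "{u}" "verts G"] by fastforce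
  then obtain v where v: "v \<in> verts G" "v \<noteq> u" by blast
  then have "u \<rightarrow>\<^sup>* v" using assms by auto
  then have "\<exists>w. u \<rightarrow> w"
    using v(2) by (metis converse_reachable_cases)
  then have "out_degree G u > 0"
    unfolding out_degree_eq_card_successors by (auto simp: card_gt_0_iff dest: adj_in_verts)
  moreover have "(\<Sum>v\<in>verts G. transition_prob G u v)
      = real (card {v \<in> verts G. u \<rightarrow> v}) * (1 / real (out_degree G u))"
    unfolding transition_prob_def by (simp add: sum.If_cases Int_def)
  ultimately show ?thesis
    by (simp add: out_degree_eq_card_successors card_gt_0_iff)
qed

section \<open>The Laplacian as a quadratic form on vertex functions\<close>

definition flow :: "('a, 'b) pre_digraph \<Rightarrow> ('a \<Rightarrow> real) \<Rightarrow> 'a \<Rightarrow> 'a \<Rightarrow> real" where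
  "flow G p u v = p u * transition_prob G u v"

text \<open>
  The change of variables that turns the \<open>p\<close>-weighted inner product of vertex functions into the
  standard inner product of vectors.
\<close>

definition sqrt_weighted :: "'a list \<Rightarrow> ('a \<Rightarrow> real) \<Rightarrow> ('a \<Rightarrow> real) \<Rightarrow> real vec" where
  "sqrt_weighted vs p f = vec (length vs) (\<lambda>i. sqrt (p (vs ! i)) * f (vs ! i))"

lemma sum_nth_distinct:
  assumes "distinct vs"
  shows "(\<Sum>i = 0..<length vs. g (vs ! i)) = (\<Sum>v\<in>set vs. g v)"
  using sum.reindex_bij_betw[OF bij_betw_nth[OF assms refl refl], of g] by (simp add: atLeast0LessThan)

lemma sqrt_weighted_scalar_prod:
  assumes "distinct vs" "\<And>v. v \<in> set vs \<Longrightarrow> 0 \<le> p v"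
  shows "sqrt_weighted vs p f \<bullet> sqrt_weighted vs p g = (\<Sum>v\<in>set vs. p v * (f v * g v))"
proof -
  have "sqrt_weighted vs p f \<bullet> sqrt_weighted vs p g
      = (\<Sum>i = 0..<length vs. (\<lambda>v. p v * (f v * g v)) (vs ! i))"
    unfolding scalar_prod_def sqrt_weighted_def
    using assms(2) by (auto intro!: sum.cong simp: algebra_simps)
  also have "\<dots> = (\<Sum>v\<in>set vs. p v * (f v * g v))"
    by (rule sum_nth_distinct[OF assms(1)])
  finally show ?thesis .
qed

lemma exists_sqrt_weighted:
  assumes "distinct vs" "\<And>v. v \<in> set vs \<Longrightarrow> 0 < p v" and x: "x \<in> carrier_vec (length vs)"
  shows "\<exists>f. x = sqrt_weighted vs p f"
proof
  let ?f = "\<lambda>v. x $ (THE i. i < length vs \<and> vs ! i = v) / sqrt (p v)"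
  have "(THE j. j < length vs \<and> vs ! j = vs ! i) = i" if "i < length vs" for i
    using that assms(1) by (auto simp: nth_eq_iff_index_eq)
  moreover have "sqrt (p (vs ! i)) \<noteq> 0" if "i < length vs" for i
    using assms(2)[of "vs ! i"] that by simp
  ultimately show "x = sqrt_weighted vs p ?f"
    unfolding sqrt_weighted_def using x by (intro eq_vecI) auto
qed

lemma laplacian_carrier: "laplacian G p vs \<in> carrier_mat (length vs) (length vs)"
proof -
  have "transpose_mat (transition_matrix G vs) \<in> carrier_mat (length vs) (length vs)"
    by (simp add: transition_matrix_def)
  from mult_carrier_mat[OF mult_carrier_mat[OF mat_diag_dim this] mat_diag_dim]
  show ?thesis
    unfolding laplacian_def Let_def
    by (intro minus_carrier_mat smult_carrier_mat add_carrier_mat)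
qed

lemma laplacian_index:
  assumes "i < length vs" "j < length vs"
  shows "laplacian G p vs $$ (i, j) = (if i = j then 1 else 0)
    - (sqrt (p (vs ! i)) * transition_prob G (vs ! i) (vs ! j) / sqrt (p (vs ! j))
      + transition_prob G (vs ! j) (vs ! i) * sqrt (p (vs ! j)) / sqrt (p (vs ! i))) / 2"
proof -
  let ?n = "length vs"
  have scale: "(mat_diag ?n a * M * mat_diag ?n b) $$ (i, j) = a i * M $$ (i, j) * b j"
    if M: "M \<in> carrier_mat ?n ?n" for M :: "real mat" and a b
  proof -
    have "mat_diag ?n a * M \<in> carrier_mat ?n ?n"
      by (rule mult_carrier_mat[OF mat_diag_dim M])
    then show ?thesis
      using assms by (simp only: mat_diag_mult_right mat_diag_mult_left[OF M]) simp
  qed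
  have P: "transition_matrix G vs \<in> carrier_mat ?n ?n"
    by (simp add: transition_matrix_def)
  then have PT: "transpose_mat (transition_matrix G vs) \<in> carrier_mat ?n ?n"
    by simp
  have dims: "A * M * mat_diag ?n b \<in> carrier_mat ?n ?n"
    if "A \<in> carrier_mat ?n ?n" "M \<in> carrier_mat ?n ?n" for A M :: "real mat" and b
    using that mult_carrier_mat mat_diag_dim by metis
  have entry: "(1\<^sub>m ?n - (1/2) \<cdot>\<^sub>m (A + B)) $$ (i, j)
      = (if i = j then 1 else 0) - (A $$ (i, j) + B $$ (i, j)) / 2"
    if "A \<in> carrier_mat ?n ?n" "B \<in> carrier_mat ?n ?n" for A B :: "real mat"
    using that assms by simp
  show ?thesis
    unfolding laplacian_def Let_def
      entry[OF dims[OF mat_diag_dim P] dims[OF mat_diag_dim PT]] scale[OF P] scale[OF PT]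
    using assms by (simp add: transition_matrix_def)
qed

lemma laplacian_symmetric: "transpose_mat (laplacian G p vs) = laplacian G p vs"
proof (rule eq_matI)
  fix i j assume "i < dim_row (laplacian G p vs)" "j < dim_col (laplacian G p vs)"
  then show "transpose_mat (laplacian G p vs) $$ (i, j) = laplacian G p vs $$ (i, j)"
    using laplacian_carrier[of G p vs] by (simp add: laplacian_index mult_ac add_ac)
qed (use laplacian_carrier[of G p vs] in auto)

text \<open>
  In the variables \<open>f\<close> all square roots cancel. For a stationary \<open>p\<close> the function on the right is \<open>f u\<close>
  minus the average of \<open>f\<close> over the in- and out-flow at \<open>u\<close>.
\<close>

lemma laplacian_mult:
  assumes "distinct vs" "\<And>v. v \<in> set vs \<Longrightarrow> 0 < p v"
  shows "laplacian G p vs *\<^sub>v sqrt_weighted vs p f = sqrt_weighted vs p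
    (\<lambda>u. (p u * f u - (\<Sum>v\<in>set vs. (flow G p u v + flow G p v u) * f v) / 2) / p u)"
    (is "?L *\<^sub>v ?x = sqrt_weighted vs p ?g")
proof (rule eq_vecI)
  fix i assume "i < dim_vec (sqrt_weighted vs p ?g)"
  then have i: "i < length vs" by (simp add: sqrt_weighted_def)
  define u where "u = vs ! i"
  have pos: "p v > 0" "sqrt (p v) > 0" "sqrt (p v) * sqrt (p v) = p v" if "v \<in> set vs" for v
    using assms(2)[OF that] by auto
  have u: "u \<in> set vs" using i by (simp add: u_def)
  have "(?L *\<^sub>v ?x) $ i = (\<Sum>j = 0..<length vs. ?L $$ (i, j) * ?x $ j)"
    using i laplacian_carrier[of G p vs]
    by (simp add: scalar_prod_def sqrt_weighted_def)
  also have "\<dots> = (\<Sum>j = 0..<length vs. (if i = j then sqrt (p u) * f u else 0)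
      - (\<lambda>v. (flow G p u v + flow G p v u) * f v / (2 * sqrt (p u))) (vs ! j))"
  proof (rule sum.cong)
    fix j assume "j \<in> {0..<length vs}"
    then have j: "j < length vs" and v: "vs ! j \<in> set vs" by auto
    have *: "(a * P / b + R * b / a) / 2 * (b * y) = (a * a * P + b * b * R) * y / (2 * a)"
      if "0 < a" "0 < b" for a b P R y :: real
      using that by (simp add: field_simps)
    show "?L $$ (i, j) * ?x $ j = (if i = j then sqrt (p u) * f u else 0)
      - (\<lambda>v. (flow G p u v + flow G p v u) * f v / (2 * sqrt (p u))) (vs ! j)"
      using *[OF pos(2)[OF u] pos(2)[OF v]] pos(3)[OF u] pos(3)[OF v] j
      by (auto simp: laplacian_index[OF i j] left_diff_distrib sqrt_weighted_def flow_def u_def)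
  qed simp
  also have "\<dots> = sqrt (p u) * f u
      - (\<Sum>v\<in>set vs. (flow G p u v + flow G p v u) * f v / (2 * sqrt (p u)))"
    unfolding sum_subtractf
      sum_nth_distinct[OF assms(1), of "\<lambda>v. (flow G p u v + flow G p v u) * f v / (2 * sqrt (p u))"]
    using i by simp
  also have "\<dots> = sqrt (p u) * f u
      - (\<Sum>v\<in>set vs. (flow G p u v + flow G p v u) * f v) / (2 * sqrt (p u))"
    by (simp add: sum_divide_distrib)
  also have "\<dots> = sqrt (p u) * ?g u"
  proof -
    have "b * y - T / (2 * b) = b * ((b * b * y - T / 2) / (b * b))" if "0 < b" for b y T :: real
      using that by (simp add: field_simps)
    from this[OF pos(2)[OF u]] show ?thesis unfolding pos(3)[OF u] .
  qed
  also have "\<dots> = sqrt_weighted vs p ?g $ i"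
    using i by (simp add: sqrt_weighted_def u_def)
  finally show "(?L *\<^sub>v ?x) $ i = sqrt_weighted vs p ?g $ i" .
qed (use laplacian_carrier[of G p vs] in \<open>simp add: sqrt_weighted_def\<close>)

section \<open>The spectral gap\<close>

text \<open>
  The variational lower bound: the hypothesis is applied to the single function \<open>f\<close> that represents a
  second eigenvector, for which the energy equals the eigenvalue times the \<open>p\<close>-weighted square sum.
\<close>

lemma (in digraph) spectral_gap_ge:
  fixes p :: "'a \<Rightarrow> real"
  assumes sc: "strongly_connected G" and n: "2 \<le> card (verts G)"
    and vs: "distinct vs" "set vs = verts G" and p: "is_perron_vector G p"
    and poincare: "\<And>f. (\<Sum>v\<in>verts G. p v * f v) = 0 \<Longrightarrow> C * (\<Sum>v\<in>verts G. p v * (f v)\<^sup>2)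
      \<le> (\<Sum>u\<in>verts G. \<Sum>v\<in>verts G. flow G p u v * (f u - f v)\<^sup>2) / 2"
  shows "C \<le> sorted_eigenvalues (laplacian G p vs) ! 1"
proof -
  let ?V = "verts G" and ?n = "length vs" and ?L = "laplacian G p vs"
  let ?E = "\<lambda>f. (\<Sum>u\<in>?V. \<Sum>v\<in>?V. flow G p u v * (f u - f v)\<^sup>2) / 2"
  let ?s = "sqrt_weighted vs p (\<lambda>_. 1)"
  have pos: "0 < p v" if "v \<in> set vs" for v
    using p that vs by (simp add: is_perron_vector_def)
  have row: "(\<Sum>v\<in>?V. flow G p u v) = p u" if "u \<in> ?V" for u
    using transition_prob_sum[OF sc n that] by (simp add: flow_def flip: sum_distrib_left)
  have col: "(\<Sum>u\<in>?V. flow G p u v) = p v" if "v \<in> ?V" for v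
    using p that by (simp add: is_perron_vector_def flow_def)
  have carrier: "sqrt_weighted vs p f \<in> carrier_vec ?n" for f
    by (simp add: sqrt_weighted_def)
  have inner: "sqrt_weighted vs p f \<bullet> sqrt_weighted vs p g = (\<Sum>v\<in>?V. p v * (f v * g v))" for f g
    using sqrt_weighted_scalar_prod[OF vs(1)] pos vs(2) less_imp_le by metis
  have L_mult: "?L *\<^sub>v sqrt_weighted vs p f = sqrt_weighted vs p
    (\<lambda>u. (p u * f u - (\<Sum>v\<in>?V. (flow G p u v + flow G p v u) * f v) / 2) / p u)" for f
    using laplacian_mult[OF vs(1), of p G f] pos unfolding vs(2) by blast
  have form: "sqrt_weighted vs p f \<bullet> (?L *\<^sub>v sqrt_weighted vs p f) = ?E f" for f
  proof -
    have "sqrt_weighted vs p f \<bullet> (?L *\<^sub>v sqrt_weighted vs p f)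
        = (\<Sum>u\<in>?V. f u * (p u * f u - (\<Sum>v\<in>?V. (flow G p u v + flow G p v u) * f v) / 2))"
      unfolding L_mult inner
    proof (rule sum.cong)
      fix u assume "u \<in> ?V"
      then have "p u \<noteq> 0" using pos vs(2) by fastforce
      then show "p u * (f u * ((p u * f u
            - (\<Sum>v\<in>?V. (flow G p u v + flow G p v u) * f v) / 2) / p u))
          = f u * (p u * f u - (\<Sum>v\<in>?V. (flow G p u v + flow G p v u) * f v) / 2)"
        by simp
    qed simp
    then show ?thesis using circulation_energy[of ?V "flow G p" p f] row col by simp
  qed
  have psd: "0 \<le> x \<bullet> (?L *\<^sub>v x)" if "x \<in> carrier_vec ?n" for x
  proof -
    obtain f where f: "x = sqrt_weighted vs p f"
      using exists_sqrt_weighted[OF vs(1), of p x] pos \<open>x \<in> carrier_vec ?n\<close> by blast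
    have "0 \<le> flow G p u v" if "u \<in> ?V" for u v
      using pos[of u] that vs(2) by (simp add: flow_def transition_prob_def)
    then show ?thesis unfolding f form by (simp add: sum_nonneg)
  qed
  have "p u - (\<Sum>v\<in>?V. flow G p u v + flow G p v u) / 2 = 0" if "u \<in> set vs" for u
    using row[of u] col[of u] that vs(2) by (simp add: sum.distrib)
  then have "p (vs ! i) - (\<Sum>v\<in>?V. flow G p (vs ! i) v + flow G p v (vs ! i)) / 2 = 0"
    if "i < ?n" for i using that by simp
  then have Ls: "?L *\<^sub>v ?s = 0\<^sub>v ?n"
    unfolding L_mult by (intro eq_vecI) (simp_all add: sqrt_weighted_def)
  have n': "2 \<le> ?n" using n vs distinct_card by metis
  obtain x where x: "x \<in> carrier_vec ?n" "x \<noteq> 0\<^sub>v ?n" "x \<bullet> ?s = 0"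
    "?L *\<^sub>v x = (sorted_eigenvalues ?L ! 1) \<cdot>\<^sub>v x"
    using second_eigenvector[OF laplacian_carrier laplacian_symmetric n' psd carrier Ls refl]
    by blast
  obtain f where f: "x = sqrt_weighted vs p f"
    using exists_sqrt_weighted[OF vs(1), of p x] pos x(1) by blast
  have S: "x \<bullet> x = (\<Sum>v\<in>?V. p v * (f v)\<^sup>2)"
    unfolding f inner by (simp add: power2_eq_square)
  have "x \<bullet> x > 0"
    using conjugate_square_greater_0_vec[OF x(1)] x(2) by simp
  moreover have "C * (x \<bullet> x) \<le> sorted_eigenvalues ?L ! 1 * (x \<bullet> x)"
  proof -
    have "(\<Sum>v\<in>?V. p v * f v) = 0" using x(3) unfolding f inner by simp
    then have "C * (x \<bullet> x) \<le> ?E f" unfolding S by (rule poincare)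
    also have "\<dots> = x \<bullet> (?L *\<^sub>v x)" unfolding f form ..
    also have "\<dots> = sorted_eigenvalues ?L ! 1 * (x \<bullet> x)" using x by simp
    finally show ?thesis .
  qed
  ultimately show ?thesis by (simp add: mult_le_cancel_right)
qed

theorem theorem4p14:
  fixes G :: "('a, 'b) pre_digraph"
    and vs :: "'a list"
    and m \<phi> :: "'a \<Rightarrow> real"
    and K lambda1 :: real
    and n :: nat
  assumes "digraph G"
    and "strongly_connected G"
    and "distinct vs" and "set vs = verts G"
    and "n = card (verts G)"
    and "\<exists>K'. solves_dist G K'"
    and "\<exists>K'. solves_dist_transpose G K'"
    and "is_out_curvature G m"
    and "is_perron_vector G \<phi>"
    and "K > 0"
    and "Min (m ` verts G) \<ge> K"
    and "lambda1 = sorted_eigenvalues (laplacian G \<phi> vs) ! 1"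
  shows "lambda1 \<ge> min_arc_flow G \<phi> / (2 * real n) * ((\<Sum>w\<in>verts G. m w) + Min (m ` verts G)) \<and>
         min_arc_flow G \<phi> / (2 * real n) * ((\<Sum>w\<in>verts G. m w) + Min (m ` verts G))
           \<ge> min_arc_flow G \<phi> / (2 * real n) * ((real n + 1) * K)"
proof -
  interpret digraph G by fact
  let ?V = "verts G" and ?c = "min_arc_flow G \<phi>" and ?M = "\<Sum>w\<in>verts G. m w"
  let ?k = "Min (m ` verts G)"
  have ne: "?V \<noteq> {}" using \<open>strongly_connected G\<close> by (simp add: strongly_connected_def)
  have m: "solves_dist G m" using \<open>is_out_curvature G m\<close> by (simp add: is_out_curvature_def)
  have k: "?k \<le> m v" if "v \<in> ?V" for v using that by simp
  have n2: "2 \<le> card ?V" using solves_dist_card_ge_2[OF m ne] .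
  have \<phi>: "0 \<le> \<phi> v" if "v \<in> ?V" for v
    using \<open>is_perron_vector G \<phi>\<close> that by (auto simp: is_perron_vector_def less_imp_le)
  have \<phi>1: "(\<Sum>v\<in>?V. \<phi> v) = 1"
    using \<open>is_perron_vector G \<phi>\<close> by (simp add: is_perron_vector_def)
  have flow0: "0 \<le> flow G \<phi> u v" if "u \<in> ?V" for u v
    using \<phi>[OF that] by (simp add: flow_def transition_prob_def)
  have c_flow: "?c = Min ((\<lambda>(u, v). flow G \<phi> u v) ` arcs_ends G)"
    by (simp add: min_arc_flow_def flow_def)
  have fin: "finite (arcs_ends G)" by (simp add: arcs_ends_def)
  have c_le: "?c \<le> flow G \<phi> u v" if "(u, v) \<in> arcs_ends G" for u v
    unfolding c_flow using fin that by (intro Min_le) (auto intro: rev_image_eqI)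
  have "arcs_ends G \<noteq> {}"
  proof
    assume "arcs_ends G = {}"
    then have "\<And>u. u \<in> ?V \<Longrightarrow> (\<Sum>v\<in>?V. transition_prob G u v) = 0"
      by (simp add: transition_prob_def)
    then show False
      using transition_prob_sum[OF \<open>strongly_connected G\<close> n2] ne by fastforce
  qed
  then have "?c \<in> (\<lambda>(u, v). flow G \<phi> u v) ` arcs_ends G"
    unfolding c_flow using fin by (intro Min_in) auto
  then have c0: "0 \<le> ?c" using flow0 by (auto dest: adj_in_verts)
  have n: "0 < real n" using n2 \<open>n = card ?V\<close> by simp
  have "?c / (2 * real n) * (?M + ?k) \<le> lambda1"
    unfolding \<open>lambda1 = _\<close>
  proof (rule spectral_gap_ge)
    fix f assume f: "(\<Sum>v\<in>?V. \<phi> v * f v) = 0"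
    let ?S = "\<Sum>v\<in>?V. \<phi> v * (f v)\<^sup>2"
    have "?c / (2 * real n) * (?M + ?k) * ?S = ?c / (2 * real n) * ((?M + ?k) * ?S)"
      by simp
    also have "\<dots> \<le> ?c / (2 * real n) * (real n * arc_energy G f)"
      using poincare_inequality[OF \<open>strongly_connected G\<close> m k _ \<phi> \<phi>1 f]
        c0 \<open>K > 0\<close> \<open>?k \<ge> K\<close> \<open>n = card ?V\<close>
      by (intro mult_left_mono) auto
    also have "\<dots> = ?c * arc_energy G f / 2" using n by simp
    also have "\<dots> \<le> (\<Sum>u\<in>?V. \<Sum>v\<in>?V. flow G \<phi> u v * (f u - f v)\<^sup>2) / 2"
      using arc_energy_le_weighted[OF c_le flow0] by simp
    finally show "?c / (2 * real n) * (?M + ?k) * ?S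
      \<le> (\<Sum>u\<in>?V. \<Sum>v\<in>?V. flow G \<phi> u v * (f u - f v)\<^sup>2) / 2" .
  qed fact+
  moreover have "?c / (2 * real n) * ((real n + 1) * K) \<le> ?c / (2 * real n) * (?M + ?k)"
  proof (rule mult_left_mono)
    have "real n * K = (\<Sum>w\<in>?V. K)" using \<open>n = card ?V\<close> by simp
    also have "\<dots> \<le> ?M" using order_trans[OF \<open>?k \<ge> K\<close> k] by (intro sum_mono) simp
    finally show "(real n + 1) * K \<le> ?M + ?k" using \<open>?k \<ge> K\<close> by (simp add: distrib_right)
  qed (use c0 in simp)
  ultimately show ?thesis by simp
qed

end
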